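(* Suppose $\xi_1<0<\xi_2$. Let $s_0:=-\xi_1/(\xi_2/p_2-\xi_1)$, and let $$P_1:=\frac{c_2/p_2-c_1}{1-p_1},\qquad P_2:=\frac{c_1(1-s_0)+c_2s_0/p_2}{p_1+(1-p_1)s_0}.$$ Then a provider-optimal policy $(i^*,s^* )$ is $$(i^*,s^* )=\begin{cases}(1,0) & \text{if } \frac{c_1}{p_1}>\frac{c_2}{p_2} \text{ and } P<P_1,\\ (2,0) & \text{if } \frac{c_1}{p_1}>\frac{c_2}{p_2} \text{ and } P>P_1,\\ (1,0) & \text{if } \frac{c_1}{p_1}<\frac{c_2}{p_2} \text{ and } P<P_2,\\ (1,s_0) & \text{if } \frac{c_1}{p_1}<\frac{c_2}{p_2} \text{ and } P>P_2.\end{cases}$$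
   Context: Two models $M_1,M_2$ have success probabilities $0<p_1<p_2<1$, user latencies $t_1<t_2$ in $[0,1]$, and provider costs $c_1<c_2$ in $[0,1]$. A success is worth $V>0$ to the user, abandonment costs the provider a penalty $P>0$, and $\xi_i:=Vp_i-t_i$ for $i\in\{1,2\}$. A provider policy is a pair $(i,s)$ with $i\in\{1,2\}$ the initial model and $s\in[0,1]$ the probability of cascading from $M_1$ to $M_2$ after a failure of $M_1$ (if $i=2$ the value of $s$ is irrelevant and the policy is written $(2,0)$). The user chooses an abandonment probability $q\in[0,1]$. Let $\alpha(q):=(1-p_1)(1-q)$, $\beta(q):=\frac{1}{p_2+(1-p_2)q}$, and $$S_1(s,q)=\tfrac{p_1+\alpha(q)\beta(q)p_2 s}{1-\alpha(q)(1-s)},\quad L_1(s,q)=\tfrac{t_1+\alpha(q)\beta(q)t_2 s}{1-\alpha(q)(1-s)},\quad C_1(s,q)=\tfrac{c_1+\alpha(q)\beta(q)c_2 s}{1-\alpha(q)(1-s)},$$ $$S_2(s,q)=\beta(q)p_2,\quad L_2(s,q)=\beta(q)t_2,\quad C_2(s,q)=\beta(q)c_2$$ (success probability, expected latency, expected service cost). User utility: $U_i(s,q):=VS_i(s,q)-L_i(s,q)$. Provider cost: $J_i(s,q):=C_i(s,q)+P(1-S_i(s,q))$. The user best response is $q^*(i,s)\in\arg\max_{q\in[0,1]}U_i(s,q)$, with the tie at $i=1$, $s=s_0$ resolved as $q^*(1,s_0)=0$ (so in this regime $q^*(1,s)=\mathbf 1\{s<s_0\}$ and $q^*(2,s)=0$).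 A policy $(i^*,s^* )$ is provider-optimal if it minimizes $J_i(s,q^*(i,s))$ over all $(i,s)\in\{1,2\}\times[0,1]$. *)

theory Defs
  imports Complex_Main
begin

datatype model = M1 | M2

text \<open>
  A policy \<open>(i, s)\<close> consists of the initial model \<open>i\<close> and the probability \<open>s\<close> of
  cascading from \<open>M1\<close> to \<open>M2\<close> after a failure of \<open>M1\<close>.  For \<open>i = M2\<close> the value
  of \<open>s\<close> is irrelevant.

  Parameters of the functions below: success probabilities \<open>p\<close>, user latencies \<open>t\<close> and
  provider costs \<open>c\<close> of the two models, the value \<open>V\<close> of a success to the user, the
  provider's abandonment penalty \<open>P\<close>, and the user's abandonment probability \<open>q\<close>.
\<close>

type_synonym policy = "model \<times> real"

definition policies :: "policy set" where
  "policies = UNIV \<times> {0..1}"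

definition xi :: "real \<Rightarrow> (model \<Rightarrow> real) \<Rightarrow> (model \<Rightarrow> real) \<Rightarrow> model \<Rightarrow> real" where
  "xi V p t i = V * p i - t i"

definition alpha :: "(model \<Rightarrow> real) \<Rightarrow> real \<Rightarrow> real" where
  "alpha p q = (1 - p M1) * (1 - q)"

definition beta :: "(model \<Rightarrow> real) \<Rightarrow> real \<Rightarrow> real" where
  "beta p q = 1 / (p M2 + (1 - p M2) * q)"

fun success_prob :: "(model \<Rightarrow> real) \<Rightarrow> model \<Rightarrow> real \<Rightarrow> real \<Rightarrow> real" where
  "success_prob p M1 s q =
     (p M1 + alpha p q * beta p q * p M2 * s) / (1 - alpha p q * (1 - s))"
| "success_prob p M2 s q = beta p q * p M2"

fun latency :: "(model \<Rightarrow> real) \<Rightarrow> (model \<Rightarrow> real) \<Rightarrow> model \<Rightarrow> real \<Rightarrow> real \<Rightarrow> real" where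
  "latency p t M1 s q =
     (t M1 + alpha p q * beta p q * t M2 * s) / (1 - alpha p q * (1 - s))"
| "latency p t M2 s q = beta p q * t M2"

fun service_cost :: "(model \<Rightarrow> real) \<Rightarrow> (model \<Rightarrow> real) \<Rightarrow> model \<Rightarrow> real \<Rightarrow> real \<Rightarrow> real" where
  "service_cost p c M1 s q =
     (c M1 + alpha p q * beta p q * c M2 * s) / (1 - alpha p q * (1 - s))"
| "service_cost p c M2 s q = beta p q * c M2"

definition user_utility ::
  "real \<Rightarrow> (model \<Rightarrow> real) \<Rightarrow> (model \<Rightarrow> real) \<Rightarrow> model \<Rightarrow> real \<Rightarrow> real \<Rightarrow> real" where
  "user_utility V p t i s q = V * success_prob p i s q - latency p t i s q"

definition provider_cost ::
  "real \<Rightarrow> (model \<Rightarrow> real) \<Rightarrow> (model \<Rightarrow> real) \<Rightarrow> model \<Rightarrow> real \<Rightarrow> real \<Rightarrow> real" where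
  "provider_cost P p c i s q = service_cost p c i s q + P * (1 - success_prob p i s q)"

text \<open>
  A selection \<open>qs\<close> of a best response to every policy.  Ties between maximizers are left
  open here.
\<close>

definition best_response ::
  "real \<Rightarrow> (model \<Rightarrow> real) \<Rightarrow> (model \<Rightarrow> real) \<Rightarrow> (model \<Rightarrow> real \<Rightarrow> real) \<Rightarrow> bool" where
  "best_response V p t qs \<longleftrightarrow>
     (\<forall>(i, s) \<in> policies. is_arg_max (user_utility V p t i s) (\<lambda>q. q \<in> {0..1}) (qs i s))"

definition provider_optimal ::
  "real \<Rightarrow> (model \<Rightarrow> real) \<Rightarrow> (model \<Rightarrow> real) \<Rightarrow> (model \<Rightarrow> real \<Rightarrow> real) \<Rightarrow> policy \<Rightarrow> bool" where
  "provider_optimal P p c qs \<pi> \<longleftrightarrow>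
     is_arg_min (\<lambda>(i, s). provider_cost P p c i s (qs i s)) (\<lambda>\<pi>'. \<pi>' \<in> policies) \<pi>"

end

theory Submission
  imports Defs
begin

text \<open>
  Relative to abandoning at once, the user gains
  \<open>\<alpha> / (1 - \<alpha> (1 - s)) * (\<beta> \<xi>\<^sub>2 s + \<xi>\<^sub>1 (1 - s))\<close> under the policy \<open>(1, s)\<close>.  Both
  factors decrease in \<open>q\<close>, so the best response is \<open>0\<close> or \<open>1\<close>, according to the sign of the
  second factor at \<open>q = 0\<close>, which changes at \<open>s\<^sub>0\<close>.  The provider therefore pays
  \<open>c\<^sub>1 + P (1 - p\<^sub>1)\<close> for \<open>s < s\<^sub>0\<close>.  For \<open>s \<ge> s\<^sub>0\<close> the user never abandons, and the cost is the average
  of \<open>c\<^sub>1 / p\<^sub>1\<close> and \<open>c\<^sub>2 / p\<^sub>2\<close> with weights \<open>p\<^sub>1\<close> and \<open>(1 - p\<^sub>1) s\<close>, which is monotone in \<open>s\<close>.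
\<close>

section \<open>Bounds and monotonicity of \<alpha> and \<beta>\<close>

lemma alpha_bounds:
  assumes "0 < p M1" "p M1 < 1" "q \<in> {0..1}"
  shows "0 \<le> alpha p q" "alpha p q < 1"
proof -
  show "0 \<le> alpha p q"
    using assms by (simp add: alpha_def)
  have "(1 - p M1) * (1 - q) \<le> (1 - p M1) * 1"
    using assms by (intro mult_left_mono) auto
  also have "\<dots> < 1"
    using assms by simp
  finally show "alpha p q < 1"
    by (simp add: alpha_def)
qed

lemma alpha_strict_antimono:
  assumes "p M1 < 1" "q < r"
  shows "alpha p r < alpha p q"
  using assms by (simp add: alpha_def)

lemma beta_strict_antimono:
  assumes "0 < p M2" "p M2 < 1" "0 \<le> q" "q < r"
  shows "beta p r < beta p q"
  using assms unfolding beta_def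
  by (intro divide_strict_left_mono mult_pos_pos add_pos_nonneg add_strict_left_mono
      mult_strict_left_mono) auto

lemma cascade_denominator_pos:
  fixes a s :: real
  assumes "0 \<le> a" "a < 1" "0 \<le> s"
  shows "0 < 1 - a * (1 - s)"
proof -
  have "a * (1 - s) \<le> a * 1"
    using assms by (intro mult_left_mono) auto
  then show ?thesis
    using assms by simp
qed

section \<open>The user's best response\<close>

lemma user_utility_M2: "user_utility V p t M2 s q = beta p q * xi V p t M2"
  by (simp add: user_utility_def xi_def algebra_simps)

text \<open>Subtracting \<open>xi V p t M1\<close> times the denominator from the numerator of the
  utility leaves a multiple of \<alpha>.\<close>

lemma user_utility_M1:
  assumes "1 - alpha p q * (1 - s) \<noteq> 0"
  shows "user_utility V p t M1 s q =
    xi V p t M1 + alpha p q / (1 - alpha p q * (1 - s)) *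
      (beta p q * xi V p t M2 * s + xi V p t M1 * (1 - s))"
proof -
  have "user_utility V p t M1 s q =
      (xi V p t M1 + alpha p q * beta p q * xi V p t M2 * s) / (1 - alpha p q * (1 - s))"
    by (simp add: user_utility_def xi_def algebra_simps diff_divide_distrib add_divide_distrib)
  also have "\<dots> = xi V p t M1 + alpha p q / (1 - alpha p q * (1 - s)) *
      (beta p q * xi V p t M2 * s + xi V p t M1 * (1 - s))"
    using assms by (simp add: divide_simps) (simp add: algebra_simps)
  finally show ?thesis .
qed

lemma user_utility_M1_abandon: "user_utility V p t M1 s 1 = xi V p t M1"
  by (simp add: user_utility_M1 alpha_def)

text \<open>Since \<open>best_response\<close> leaves ties open, it determines \<open>qs\<close>
  only where the maximizer is unique. Hence the strict inequalities in the lemmas below.\<close>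

lemma best_response_unique:
  assumes "best_response V p t qs" "s \<in> {0..1}" "r \<in> {0..1}"
    and "\<And>q. q \<in> {0..1} \<Longrightarrow> q \<noteq> r \<Longrightarrow> user_utility V p t i s q < user_utility V p t i s r"
  shows "qs i s = r"
proof -
  have "is_arg_max (user_utility V p t i s) (\<lambda>q. q \<in> {0..1}) (qs i s)"
    using assms(1,2) by (auto simp: best_response_def policies_def)
  then show ?thesis
    using assms(3,4) by (auto simp: is_arg_max_def)
qed

lemma best_response_M2:
  assumes "best_response V p t qs" "s \<in> {0..1}" "0 < p M2" "p M2 < 1" "0 < xi V p t M2"
  shows "qs M2 s = 0"
  using assms(1,2)
  by (rule best_response_unique)
    (use assms in \<open>auto simp: user_utility_M2 intro!: beta_strict_antimono\<close>)

text \<open>The second factor of the gain is largest at q = 0, so it is negative for every q. For q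
  < 1 its weight is positive, and staying is a strict loss.\<close>

lemma best_response_M1_abandon:
  assumes best: "best_response V p t qs" and s: "s \<in> {0..1}"
    and p: "0 < p M1" "p M1 < 1" "0 < p M2" "p M2 < 1" and xi: "0 < xi V p t M2"
    and neg: "beta p 0 * xi V p t M2 * s + xi V p t M1 * (1 - s) < 0"
  shows "qs M1 s = 1"
  using best s
proof (rule best_response_unique)
  fix q :: real
  assume q: "q \<in> {0..1}" "q \<noteq> 1"
  have pos: "0 < 1 - alpha p q * (1 - s)"
    using s alpha_bounds[of p q] p q by (intro cascade_denominator_pos) auto
  have "beta p q \<le> beta p 0"
    using beta_strict_antimono[of p 0 q] p q by (cases "q = 0") auto
  then have "beta p q * (xi V p t M2 * s) \<le> beta p 0 * (xi V p t M2 * s)"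
    using xi s by (intro mult_right_mono) auto
  then have "beta p q * xi V p t M2 * s + xi V p t M1 * (1 - s) < 0"
    using neg by (simp add: mult.assoc)
  moreover have "0 < alpha p q / (1 - alpha p q * (1 - s))"
    using pos p q by (simp add: alpha_def)
  ultimately have "alpha p q / (1 - alpha p q * (1 - s)) *
      (beta p q * xi V p t M2 * s + xi V p t M1 * (1 - s)) < 0"
    by (simp only: mult_pos_neg)
  then show "user_utility V p t M1 s q < user_utility V p t M1 s 1"
    unfolding user_utility_M1_abandon user_utility_M1[OF less_imp_neq[OF pos, symmetric]]
    by linarith
qed auto

text \<open>The factor \<open>g\<close> may turn negative for q > 0, so the product is compared in
  two steps: raising \<open>g q\<close> to \<open>g 0\<close> needs only \<open>0 \<le> w q\<close>,
  and raising \<open>w q\<close> to \<open>w 0\<close> needs \<open>0 < g 0\<close>. Strictness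
  comes from \<open>w\<close>, as \<open>g\<close> is constant when s = 0.\<close>

lemma best_response_M1_stay:
  assumes best: "best_response V p t qs" and s: "s \<in> {0..1}"
    and p: "0 < p M1" "p M1 < 1" "0 < p M2" "p M2 < 1" and xi: "0 < xi V p t M2"
    and gain_pos: "0 < beta p 0 * xi V p t M2 * s + xi V p t M1 * (1 - s)"
  shows "qs M1 s = 0"
  using best s
proof (rule best_response_unique)
  fix q :: real
  assume q: "q \<in> {0..1}" "q \<noteq> 0"
  define w where "w r = alpha p r / (1 - alpha p r * (1 - s))" for r
  define g where "g r = beta p r * xi V p t M2 * s + xi V p t M1 * (1 - s)" for r
  have pos: "0 < 1 - alpha p r * (1 - s)" if "r \<in> {0..1}" for r
    using s alpha_bounds[of p r] p that by (intro cascade_denominator_pos) auto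
  have utility: "user_utility V p t M1 s r = xi V p t M1 + w r * g r" if "r \<in> {0..1}" for r
    using pos[OF that] by (simp add: user_utility_M1 w_def g_def)
  have w_nonneg: "0 \<le> w q"
    using pos[of q] alpha_bounds[of p q] p q by (simp add: w_def)
  have "alpha p q < alpha p 0"
    using p q by (intro alpha_strict_antimono) auto
  \<comment> \<open>The map x / (1 - x b) is increasing: cross-multiplying cancels the terms in
    b.\<close>
  then have w_less: "w q < w 0"
    using pos[of q] pos[of 0] q by (simp add: w_def divide_simps) (simp add: algebra_simps)
  have "beta p q < beta p 0"
    using p q by (intro beta_strict_antimono) auto
  then have "beta p q * (xi V p t M2 * s) \<le> beta p 0 * (xi V p t M2 * s)"
    using xi s by (intro mult_right_mono) auto
  then have "g q \<le> g 0"
    by (simp add: g_def mult.assoc)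
  then have "w q * g q \<le> w q * g 0"
    using w_nonneg by (intro mult_left_mono)
  also have "\<dots> < w 0 * g 0"
    using w_less gain_pos by (intro mult_strict_right_mono) (simp_all add: g_def)
  finally show "user_utility V p t M1 s q < user_utility V p t M1 s 0"
    using q by (simp add: utility)
qed auto

section \<open>The provider's cost\<close>

lemma provider_cost_M1_abandon: "provider_cost P p c M1 s 1 = c M1 + P * (1 - p M1)"
  by (simp add: provider_cost_def alpha_def)

text \<open>A user who never abandons succeeds with probability 1, so the penalty drops out.\<close>

lemma provider_cost_M1_stay:
  assumes "0 < p M1" "p M1 < 1" "0 < p M2" "0 \<le> s"
  shows "provider_cost P p c M1 s 0 =
    (c M1 + (1 - p M1) * s * (c M2 / p M2)) / (p M1 + (1 - p M1) * s)"
proof -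
  have "1 - (1 - p M1) * (1 - s) = p M1 + (1 - p M1) * s"
    by (simp add: algebra_simps)
  moreover have "0 < p M1 + (1 - p M1) * s"
    using assms by (intro add_pos_nonneg) auto
  ultimately show ?thesis
    using assms by (simp add: provider_cost_def alpha_def beta_def mult.commute)
qed

lemma provider_cost_M2_stay:
  assumes "p M2 \<noteq> 0"
  shows "provider_cost P p c M2 s 0 = c M2 / p M2"
  using assms by (simp add: provider_cost_def beta_def)

text \<open>Both sides average v / u and d, with weight u on the former. Cross-multiplied, their
  difference is (y - x) (d u - v).\<close>

lemma weighted_average_mono:
  fixes u v d x y :: real
  assumes "0 < u" "0 \<le> x" "x \<le> y" "v / u \<le> d"
  shows "(v + x * d) / (u + x) \<le> (v + y * d) / (u + y)"
proof -
  have "0 \<le> (y - x) * (d * u - v)"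
    using assms by (simp add: divide_simps)
  moreover have "0 < u + x" "0 < u + y"
    using assms by auto
  ultimately show ?thesis
    by (simp add: divide_simps) (simp add: algebra_simps)
qed

lemma weighted_average_le:
  fixes u v d x :: real
  assumes "0 < u" "0 \<le> x" "v / u \<le> d"
  shows "(v + x * d) / (u + x) \<le> d"
  using assms by (simp add: divide_simps add_pos_nonneg) (simp add: algebra_simps)

lemma weighted_average_ge:
  fixes u v d x :: real
  assumes "0 < u" "0 \<le> x" "d \<le> v / u"
  shows "d \<le> (v + x * d) / (u + x)"
  using assms by (simp add: divide_simps add_pos_nonneg) (simp add: algebra_simps)

section \<open>Comparison of the policies\<close>

theorem theorem4:
  fixes p t c :: "model \<Rightarrow> real" and V P s0 P1 P2 :: real
    and qs :: "model \<Rightarrow> real \<Rightarrow> real"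
  assumes "0 < p M1" "p M1 < p M2" "p M2 < 1"
    and "0 \<le> t M1" "t M1 < t M2" "t M2 \<le> 1"
    and "0 \<le> c M1" "c M1 < c M2" "c M2 \<le> 1"
    and "V > 0" "P > 0"
    and "xi V p t M1 < 0" "0 < xi V p t M2"
    and s0: "s0 = - xi V p t M1 / (xi V p t M2 / p M2 - xi V p t M1)"
    and P1: "P1 = (c M2 / p M2 - c M1) / (1 - p M1)"
    and P2: "P2 = (c M1 * (1 - s0) + c M2 * s0 / p M2) / (p M1 + (1 - p M1) * s0)"
    and best: "best_response V p t qs"
    and tie: "qs M1 s0 = 0"
  shows "(c M1 / p M1 > c M2 / p M2 \<and> P < P1 \<longrightarrow> provider_optimal P p c qs (M1, 0)) \<and>
         (c M1 / p M1 > c M2 / p M2 \<and> P > P1 \<longrightarrow> provider_optimal P p c qs (M2, 0)) \<and>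
         (c M1 / p M1 < c M2 / p M2 \<and> P < P2 \<longrightarrow> provider_optimal P p c qs (M1, 0)) \<and>
         (c M1 / p M1 < c M2 / p M2 \<and> P > P2 \<longrightarrow> provider_optimal P p c qs (M1, s0))"
proof -
  define a where "a = 1 - p M1"
  define d where "d = c M2 / p M2"
  define k where "k s = (c M1 + a * s * d) / (p M1 + a * s)" for s
  define e where "e = xi V p t M2 / p M2 - xi V p t M1"
  have p: "0 < p M1" "p M1 < 1" "0 < p M2" "p M2 < 1"
    using assms(1-3) by auto
  have a: "0 < a"
    using p by (simp add: a_def)
  have xi_pos: "0 < xi V p t M2"
    by fact
  have xi_ratio: "0 < xi V p t M2 / p M2"
    using xi_pos p by simp
  then have e: "0 < e"
    using \<open>xi V p t M1 < 0\<close> by (simp add: e_def)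
  have s0_e: "s0 * e = - xi V p t M1"
    using e by (simp add: s0 flip: e_def)
  have s0_pos: "0 < s0"
    using e \<open>xi V p t M1 < 0\<close> by (simp add: s0 divide_neg_pos flip: e_def)
  have s0_less: "s0 < 1"
    using e xi_ratio unfolding s0 e_def[symmetric]
    by (subst divide_less_eq_1_pos) (simp_all add: e_def)
  \<comment> \<open>As \<open>beta p 0\<close> is 1 / \<open>p M2\<close>, the second factor at q =
    0 is affine in s with slope \<open>e\<close> and root \<open>s0\<close>.\<close>
  have gain: "beta p 0 * xi V p t M2 * s + xi V p t M1 * (1 - s) = (s - s0) * e" for s
    using s0_e by (simp add: left_diff_distrib) (simp add: e_def beta_def algebra_simps)
  have qs2: "qs M2 s = 0" if "s \<in> {0..1}" for s
    using best that p(3,4) xi_pos by (rule best_response_M2)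
  have qs_abandon: "qs M1 s = 1" if "s \<in> {0..1}" "s < s0" for s
    using best that(1) p xi_pos
    by (rule best_response_M1_abandon) (use that e in \<open>simp add: gain mult_neg_pos\<close>)
  \<comment> \<open>At \<open>s0\<close> the factor vanishes at q = 0, so staying and abandoning at
    once have equal utility; \<open>tie\<close> selects staying.\<close>
  have qs_stay: "qs M1 s = 0" if "s \<in> {0..1}" "s0 \<le> s" for s
  proof (cases "s = s0")
    case False
    show ?thesis
      using best that(1) p xi_pos
      by (rule best_response_M1_stay) (use that False e in \<open>simp add: gain\<close>)
  qed (use tie in simp)
  define J where "J = (\<lambda>(i, s). provider_cost P p c i s (qs i s))"
  have J_abandon: "J (M1, s) = c M1 + P * a" if "s \<in> {0..1}" "s < s0" for s
    using that by (simp add: J_def qs_abandon provider_cost_M1_abandon a_def)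
  have J_stay: "J (M1, s) = k s" if "s \<in> {0..1}" "s0 \<le> s" for s
    using that p by (simp add: J_def qs_stay provider_cost_M1_stay k_def a_def d_def)
  have J_M2: "J (M2, s) = d" if "s \<in> {0..1}" for s
    using that p by (simp add: J_def qs2 provider_cost_M2_stay d_def)
  \<comment> \<open>Every policy costs one of three values: that of abandonment, \<open>d\<close>,
    or \<open>k s\<close> with s at least \<open>s0\<close>.\<close>
  have optimal: "provider_optimal P p c qs \<pi>"
    if \<pi>: "\<pi> \<in> policies" and le: "J \<pi> \<le> c M1 + P * a" "J \<pi> \<le> d"
      "\<And>s. s \<in> {0..1} \<Longrightarrow> s0 \<le> s \<Longrightarrow> J \<pi> \<le> k s" for \<pi>
  proof -
    have "J \<pi> \<le> J (i, s)" if "s \<in> {0..1}" for i s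
      using le that by (cases i; cases "s < s0") (auto simp: J_abandon J_stay J_M2)
    then show ?thesis
      using \<pi> unfolding provider_optimal_def J_def[symmetric]
      by (force simp: is_arg_min_linorder policies_def)
  qed
  have in_policies: "(M1, 0) \<in> policies" "(M2, 0) \<in> policies" "(M1, s0) \<in> policies"
    using s0_pos s0_less by (auto simp: policies_def)
  have J_values: "J (M1, 0) = c M1 + P * a" "J (M2, 0) = d" "J (M1, s0) = k s0"
    using s0_pos s0_less by (simp_all add: J_abandon J_stay J_M2)
  \<comment> \<open>\<open>P1\<close> is the penalty at which abandonment costs as much as starting
    with \<open>M2\<close>.\<close>
  have P1_eq: "c M1 + P1 * a = d"
    using a by (simp add: P1 flip: a_def d_def)
  have weight_pos: "0 < p M1 + a * s0"
    using p a s0_pos by (simp add: add_pos_pos)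
  \<comment> \<open>Likewise, at \<open>P2\<close> abandonment costs as much as the policy
    \<open>(M1, s0)\<close>.\<close>
  have "P2 = (c M1 * (1 - s0) + d * s0) / (p M1 + a * s0)"
    by (simp add: P2 d_def a_def)
  then have "c M1 + P2 * a =
      (c M1 * (p M1 + a * s0) + (c M1 * (1 - s0) + d * s0) * a) / (p M1 + a * s0)"
    using weight_pos by (simp add: add_frac_eq add_num_frac)
  also have "c M1 * (p M1 + a * s0) + (c M1 * (1 - s0) + d * s0) * a = c M1 + a * s0 * d"
    by (simp add: a_def algebra_simps)
  finally have P2_eq: "c M1 + P2 * a = k s0"
    by (simp add: k_def)
  have P_mono: "c M1 + x * a \<le> c M1 + y * a" if "x < y" for x y
    using that a by simp
  \<comment> \<open>If \<open>M2\<close> has the smaller ratio of cost to success, \<open>d\<close>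
    is the only rival of abandonment. Otherwise \<open>k\<close> is nondecreasing and bounded below
    by \<open>k s0\<close> on the staying side, and \<open>k s0\<close> is the rival.\<close>
  have k_ge: "d \<le> k s" if "d < c M1 / p M1" "0 \<le> s" for s
    using that p a unfolding k_def by (intro weighted_average_ge) auto
  have k_le: "k s0 \<le> d" if "c M1 / p M1 < d"
    using that p a s0_pos unfolding k_def by (intro weighted_average_le) auto
  have k_mono: "k s0 \<le> k s" if "c M1 / p M1 < d" "s0 \<le> s" for s
    using that p a s0_pos unfolding k_def by (intro weighted_average_mono) auto
  show ?thesis
    unfolding d_def[symmetric]
  proof (intro conjI impI; elim conjE)
    assume "d < c M1 / p M1" "P < P1"
    then show "provider_optimal P p c qs (M1, 0)"
      using P_mono[of P P1] P1_eq k_ge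
      by (intro optimal in_policies) (fastforce simp: J_values)+
  next
    assume "d < c M1 / p M1" "P > P1"
    then show "provider_optimal P p c qs (M2, 0)"
      using P_mono[of P1 P] P1_eq k_ge
      by (intro optimal in_policies) (auto simp: J_values)
  next
    assume "c M1 / p M1 < d" "P < P2"
    then show "provider_optimal P p c qs (M1, 0)"
      using P_mono[of P P2] P2_eq k_le k_mono
      by (intro optimal in_policies) (fastforce simp: J_values)+
  next
    assume "c M1 / p M1 < d" "P > P2"
    then show "provider_optimal P p c qs (M1, s0)"
      using P_mono[of P2 P] P2_eq k_le k_mono
      by (intro optimal in_policies) (auto simp: J_values)
  qed
qed

end
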